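(* Let $(u_n)_{n \geq 1}$ be an increasing sequence of positive integers. Then $$\sum_{n=1}^{+\infty} \frac{(-1)^{u_n - n}}{F_{u_n} \Phi^{u_n}} = \sum_{n=1}^{+\infty} (-1)^{u_{2n-1}+1} \frac{F_{u_{2n} - u_{2n-1}}}{F_{u_{2n}} F_{u_{2n-1}}}.$$ In particular, if $u_n \equiv n \pmod 2$ for every positive integer $n$, then $$\sum_{n=1}^{+\infty} \frac{1}{F_{u_n} \Phi^{u_n}} = \sum_{n=1}^{+\infty} \frac{F_{u_{2n} - u_{2n-1}}}{F_{u_{2n}} F_{u_{2n-1}}}.$$
   Context: $(F_n)$ is the Fibonacci sequence: $F_0 = 0$, $F_1 = 1$, $F_{n+2} = F_{n+1} + F_n$. $\Phi = \frac{1+\sqrt{5}}{2}$ is the golden ratio. *)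

theory Defs
  imports Complex_Main "HOL-Number_Theory.Fib" "HOL-Number_Theory.Cong"
begin

definition golden_ratio :: real where
  "golden_ratio = (1 + sqrt 5) / 2"

end

theory Submission
  imports Defs
begin

text \<open>
  Put \<open>\<psi> = - 1 / \<Phi>\<close>. Binet's formula gives \<open>F\<^sub>b \<psi>\<^sup>a - F\<^sub>a \<psi>\<^sup>b = (-1)\<^sup>a F\<^bsub>b-a\<^esub>\<close> for \<open>a \<le> b\<close>. Divided by
  \<open>- F\<^sub>a F\<^sub>b\<close>, with \<open>a\<close> and \<open>b\<close> the values of \<open>u\<close> at \<open>2n - 1\<close> and \<open>2n\<close>, this says that two consecutive
  terms of the left series add up to one term of the right series. The left series is dominated by
  the geometric series in \<open>1 / \<Phi>\<close>, so its terms may be grouped in pairs.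
\<close>

lemma golden_ratio_gt_1: "golden_ratio > 1"
proof -
  have "sqrt 5 > sqrt (1 :: real)"
    by (subst real_sqrt_less_iff) simp
  then show ?thesis
    by (simp add: golden_ratio_def)
qed

text \<open>After Binet's formula is inserted on the left, the two terms in
  \<open>\<psi> ^ (2 * a + d)\<close> cancel. What remains is \<open>(\<phi> * \<psi>) ^ a\<close>
  times Binet's expression for \<open>fib d\<close>. Writing the larger index as
  \<open>a + d\<close> avoids truncated subtraction.\<close>

lemma fib_mult_power_diff:
  fixes \<psi> :: real
  defines "\<psi> \<equiv> - 1 / golden_ratio"
  shows "real (fib (a + d)) * \<psi> ^ a - real (fib a) * \<psi> ^ (a + d) = (- 1) ^ a * real (fib d)"
proof -
  define \<phi> where "\<phi> = golden_ratio"
  \<comment> \<open>This identifies \<open>\<psi>\<close> with the conjugate root that occurs in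
    \<open>fib_closed_form\<close>.\<close>
  have "(1 - sqrt 5) / 2 * golden_ratio = - 1"
    by (simp add: golden_ratio_def field_simps)
  then have psi: "\<psi> = (1 - sqrt 5) / 2"
    unfolding \<psi>_def using golden_ratio_gt_1 by (simp add: field_simps)
  have binet: "real (fib n) = (\<phi> ^ n - \<psi> ^ n) / sqrt 5" for n
    unfolding psi \<phi>_def golden_ratio_def by (rule fib_closed_form)
  have "\<phi> * \<psi> = - 1"
    unfolding \<psi>_def \<phi>_def using golden_ratio_gt_1 by simp
  then have "(- 1) ^ a = \<phi> ^ a * \<psi> ^ a"
    by (metis power_mult_distrib)
  then show ?thesis
    unfolding binet by (simp add: field_simps power_add)
qed

text \<open>Here \<open>a\<close> stands at an odd position of the sequence and \<open>b\<close> at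
  the following even one, hence the sign exponents \<open>a + 1\<close> and \<open>b\<close>. The
  signs are absorbed into powers of \<open>\<psi>\<close>, so the left side is
  \<open>\<psi> ^ b / fib b - \<psi> ^ a / fib a\<close>.\<close>

lemma fib_golden_ratio_pair:
  assumes "0 < a" "a < b"
  shows "(- 1) ^ (a + 1) / (real (fib a) * golden_ratio ^ a)
         + (- 1) ^ b / (real (fib b) * golden_ratio ^ b)
       = (- 1) ^ (a + 1) * (real (fib (b - a)) / (real (fib b) * real (fib a)))"
proof -
  define \<psi> where "\<psi> = - 1 / golden_ratio"
  have nz: "real (fib a) \<noteq> 0" "real (fib b) \<noteq> 0"
    using assms fib_neq_0_nat[of a] fib_neq_0_nat[of b] by auto
  have pow: "(- 1) ^ n / (x * golden_ratio ^ n) = \<psi> ^ n / x" for n and x :: real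
    unfolding \<psi>_def power_divide by simp
  have "real (fib b) * \<psi> ^ a - real (fib a) * \<psi> ^ b = (- 1) ^ a * real (fib (b - a))"
    using fib_mult_power_diff[of a "b - a"] assms by (simp add: \<psi>_def)
  then have "\<psi> ^ b / real (fib b) - \<psi> ^ a / real (fib a)
      = - ((- 1) ^ a * (real (fib (b - a)) / (real (fib b) * real (fib a))))"
    using nz by (simp add: field_simps)
  then show ?thesis
    using pow[of a] pow[of b] by simp
qed

lemma strict_mono_on_atLeast_1_ge:
  fixes u :: "nat \<Rightarrow> nat"
  assumes "u 1 > 0" "strict_mono_on {1..} u"
  shows "Suc n \<le> u (Suc n)"
proof (induction n)
  case (Suc n)
  have "u (Suc n) < u (Suc (Suc n))"
    using assms(2) by (rule strict_mono_onD) auto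
  with Suc show ?case by simp
qed (use assms(1) in simp)

text \<open>As \<open>fib (v n)\<close> is at least 1 and \<open>v n\<close> at least
  \<open>n\<close>, each denominator is at least \<open>golden_ratio ^ n\<close>. Only the modulus
  of the sign \<open>s n\<close> matters.\<close>

lemma summable_fib_golden_ratio:
  fixes s :: "nat \<Rightarrow> real" and v :: "nat \<Rightarrow> nat"
  assumes "\<And>n. \<bar>s n\<bar> = 1" and "\<And>n. Suc n \<le> v n"
  shows "summable (\<lambda>n. s n / (real (fib (v n)) * golden_ratio ^ v n))"
proof (rule summable_comparison_test')
  show "summable (\<lambda>n. (1 / golden_ratio) ^ n)"
    using golden_ratio_gt_1 by (intro summable_geometric) simp
  fix n :: nat
  have v: "n \<le> v n" "0 < v n"
    using assms(2)[of n] by simp_all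
  have "1 * golden_ratio ^ n \<le> real (fib (v n)) * golden_ratio ^ v n"
    using golden_ratio_gt_1 v fib_neq_0_nat[of "v n"] by (intro mult_mono power_increasing) auto
  moreover have "golden_ratio ^ n > 0"
    using golden_ratio_gt_1 by simp
  ultimately have "1 / (real (fib (v n)) * golden_ratio ^ v n) \<le> 1 / golden_ratio ^ n"
    by (intro divide_left_mono) auto
  then show "norm (s n / (real (fib (v n)) * golden_ratio ^ v n)) \<le> (1 / golden_ratio) ^ n"
    using golden_ratio_gt_1 assms(1)[of n] by (simp add: abs_mult power_divide)
qed

theorem theorem3p1:
  fixes u :: "nat \<Rightarrow> nat"
  assumes pos: "\<And>n. n \<ge> 1 \<Longrightarrow> u n > 0"
    and incr: "strict_mono_on {1..} u"
  shows "summable (\<lambda>n. (- 1 :: real) powi (int (u (Suc n)) - int (Suc n))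
             / (real (fib (u (Suc n))) * golden_ratio ^ u (Suc n)))
       \<and> summable (\<lambda>n. (- 1 :: real) ^ (u (2 * Suc n - 1) + 1)
             * (real (fib (u (2 * Suc n) - u (2 * Suc n - 1)))
                / (real (fib (u (2 * Suc n))) * real (fib (u (2 * Suc n - 1))))))
       \<and> (\<Sum>n. (- 1 :: real) powi (int (u (Suc n)) - int (Suc n))
             / (real (fib (u (Suc n))) * golden_ratio ^ u (Suc n)))
         = (\<Sum>n. (- 1 :: real) ^ (u (2 * Suc n - 1) + 1)
             * (real (fib (u (2 * Suc n) - u (2 * Suc n - 1)))
                / (real (fib (u (2 * Suc n))) * real (fib (u (2 * Suc n - 1))))))
       \<and> ((\<forall>n\<ge>1. [u n = n] (mod 2)) \<longrightarrow>
           summable (\<lambda>n. 1 / (real (fib (u (Suc n))) * golden_ratio ^ u (Suc n)))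
         \<and> summable (\<lambda>n. real (fib (u (2 * Suc n) - u (2 * Suc n - 1)))
                / (real (fib (u (2 * Suc n))) * real (fib (u (2 * Suc n - 1)))))
         \<and> (\<Sum>n. 1 / (real (fib (u (Suc n))) * golden_ratio ^ u (Suc n)))
           = (\<Sum>n. real (fib (u (2 * Suc n) - u (2 * Suc n - 1)))
                / (real (fib (u (2 * Suc n))) * real (fib (u (2 * Suc n - 1))))))"
proof -
  let ?f = "\<lambda>n. (- 1 :: real) powi (int (u (Suc n)) - int (Suc n))
             / (real (fib (u (Suc n))) * golden_ratio ^ u (Suc n))"
  let ?h = "\<lambda>n. real (fib (u (2 * Suc n) - u (2 * Suc n - 1)))
                / (real (fib (u (2 * Suc n))) * real (fib (u (2 * Suc n - 1))))"
  let ?g = "\<lambda>n. (- 1 :: real) ^ (u (2 * Suc n - 1) + 1) * ?h n"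
  have ge: "Suc n \<le> u (Suc n)" for n
    using pos[of 1] incr by (intro strict_mono_on_atLeast_1_ge) simp_all
  \<comment> \<open>A difference and a sum of integers have the same parity, so the integer exponent
    can be traded for a natural one.\<close>
  have sign: "(- 1 :: real) powi (int (u (Suc n)) - int (Suc n)) = (- 1) ^ (u (Suc n) + Suc n)" for n
    by (auto simp: power_int_minus_left minus_one_power_iff)
  have summ: "summable ?f"
    using ge by (intro summable_fib_golden_ratio) (simp_all add: sign power_abs)
  \<comment> \<open>Series indices start at 0, so the block \<open>2 * n\<close>,
    \<open>2 * n + 1\<close> carries the values of \<open>u\<close> at \<open>2 * n + 1\<close> and
    \<open>2 * n + 2\<close>.\<close>
  have "sum ?f {n * 2..<n * 2 + 2} = ?g n" for n
  proof -
    have less: "u (2 * n + 1) < u (2 * n + 2)"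
      using incr by (rule strict_mono_onD) auto
    have "sum ?f {n * 2..<n * 2 + 2} = ?f (2 * n) + ?f (2 * n + 1)"
      by (simp add: numeral_2_eq_2 mult.commute)
    also have "\<dots> = ?g n"
      using fib_golden_ratio_pair[OF _ less] pos[of "2 * n + 1"]
      unfolding sign by (simp add: power_add)
    finally show ?thesis .
  qed
  \<comment> \<open>Grouping a convergent series keeps its sum, which yields both the convergence of
    \<open>?g\<close> and its value.\<close>
  with sums_group[OF summable_sums[OF summ], of 2] have sums: "?g sums suminf ?f"
    by simp
  \<comment> \<open>Under the parity hypothesis every sign is 1, so the two series coincide termwise
    with the unsigned ones and inherit convergence and sums.\<close>
  have "?f = (\<lambda>n. 1 / (real (fib (u (Suc n))) * golden_ratio ^ u (Suc n))) \<and> ?g = ?h"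
    if parity: "\<forall>n\<ge>1. [u n = n] (mod 2)"
  proof -
    have even_iff: "even (u n) \<longleftrightarrow> even n" if "n \<ge> 1" for n
      using parity that by (metis cong_dvd_iff)
    have "even (u (Suc n) + Suc n)" "even (u (2 * Suc n - 1) + 1)" for n
      using even_iff[of "Suc n"] even_iff[of "2 * Suc n - 1"] by simp_all
    then show ?thesis
      unfolding sign by (simp only: power_minus_even power_one mult_1 simp_thms)
  qed
  with summ sums show ?thesis
    by (auto simp only: sums_iff)
qed

end
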